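(* Let $t\geqslant 2$ and $m\geqslant t$ be integers, let $L=\{l_1,\ldots,l_s\}$ be a set of integers with $0\leqslant l_1<l_2<\cdots<l_s$, and let $n\geqslant\binom{m}{t}l_s$ be an integer. Then $$\kappa_{L}^{t}(n,m)=\left\lfloor\frac{n(t-1)}{m}+\frac{l_s}{m}\binom{m}{t}\right\rfloor.$$
   Context: $[n]=\{1,\ldots,n\}$. A family of subsets of $[n]$ is an $m$-family if it has $m$ pairwise distinct members, and $k$-uniform if all members have size $k$. For an integer $t\geqslant 2$, a family is $t$-wise $L$-intersecting if the intersection of every $t$ (distinct) members has size in $L$. $\kappa_L^t(n,m)$ is the maximum $k$ such that there exists a $k$-uniform $t$-wise $L$-intersecting $m$-family of subsets of $[n]$.
   Formalization: As printed the claim fails in degenerate cases (e.g. t=m=2, L={0,2}, n=2). Added: if l_s=0 or m=t, [n] has at least m distinct subsets of the claimed size; if m=t, then n≥l_s+t or n−t∈L. Both conditions are necessary for the formula. *)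

theory Defs
  imports Complex_Main
begin

definition m_family :: "nat \<Rightarrow> nat \<Rightarrow> nat set set \<Rightarrow> bool" where
  "m_family n m F \<longleftrightarrow> F \<subseteq> Pow {1..n} \<and> card F = m"

definition uniform_family :: "nat \<Rightarrow> nat set set \<Rightarrow> bool" where
  "uniform_family k F \<longleftrightarrow> (\<forall>A\<in>F. card A = k)"

definition wise_intersecting :: "nat \<Rightarrow> nat set \<Rightarrow> nat set set \<Rightarrow> bool" where
  "wise_intersecting t L F \<longleftrightarrow> (\<forall>G\<subseteq>F. card G = t \<longrightarrow> card (\<Inter>G) \<in> L)"

(* For m > 0 the set below is contained in {0..n}, hence finite; if it is empty,
   its maximum does not exist and the value of kappa is unspecified. *)
definition kappa :: "nat \<Rightarrow> nat set \<Rightarrow> nat \<Rightarrow> nat \<Rightarrow> nat" where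
  "kappa t L n m =
     Max {k. \<exists>F. m_family n m F \<and> uniform_family k F \<and> wise_intersecting t L F}"

end

(* Upper bound: if d(x) is the number of members containing x, then the sum of C(d(x), t) counts the
   t-wise intersections with size, while C(d, t) >= d - (t - 1); summing over x bounds m k.

   Lower bound: with l = max L, reserve l private points for each t-subset of the m members, so that
   every t-wise intersection already has size l. On the remaining r points one needs m sets of size
   floor(r (t - 1) / m) such that no point lies in t of them. A family that minimises the sum of the
   squared degrees is such a family, because moving one set from a point x to a point y with
   d(x) >= d(y) + 2 decreases that sum.
   Pairing each set with a label allows repetitions; they do no harm when l > 0 and t < m, since the
   private points then separate the members. If m = t and n < l + t, the members are the complements
   of t distinct points. *)

theory Submission
  imports Defs
begin

section \<open>Degrees and the upper bound\<close>

text \<open>The family is indexed so that one double count serves the members (\<open>id\<close>),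
  their t-wise intersections (\<open>Inter\<close>) and labelled sets (\<open>fst\<close>).\<close>

definition degree :: "'i set \<Rightarrow> ('i \<Rightarrow> 'a set) \<Rightarrow> 'a \<Rightarrow> nat" where
  "degree F S x = card {p\<in>F. x \<in> S p}"

lemma sum_degree:
  assumes "finite F" "finite X" "\<And>p. p \<in> F \<Longrightarrow> S p \<subseteq> X"
  shows "(\<Sum>x\<in>X. degree F S x) = (\<Sum>p\<in>F. card (S p))"
proof -
  have "(\<Sum>x\<in>X. degree F S x) = (\<Sum>x\<in>X. \<Sum>p\<in>F. if x \<in> S p then 1 else 0)"
    unfolding degree_def using assms(1) by (simp add: sum.If_cases Int_def)
  also have "\<dots> = (\<Sum>p\<in>F. \<Sum>x\<in>X. if x \<in> S p then 1 else 0)"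
    by (rule sum.swap)
  also have "\<dots> = (\<Sum>p\<in>F. card (S p))"
  proof (rule sum.cong)
    fix p assume "p \<in> F"
    then have "X \<inter> {x. x \<in> S p} = S p" using assms(3) by blast
    then show "(\<Sum>x\<in>X. if x \<in> S p then 1 else 0) = card (S p)"
      using assms(2) by (simp add: sum.If_cases)
  qed simp
  finally show ?thesis .
qed

text \<open>Once d reaches t - 1, each further unit adds C(d, t - 1) >= 1 to C(d, t). Equality holds
  at d = t - 1 and d = t, the degrees that an extremal family aims for.\<close>

lemma le_choose_add: "0 < t \<Longrightarrow> d \<le> (d choose t) + (t - 1)"
proof (induction d)
  case (Suc d)
  obtain s where t: "t = Suc s" using Suc.prems by (cases t) auto
  show ?case
  proof (cases "s \<le> d")
    case True
    then have "1 \<le> d choose s" by (simp add: Suc_le_eq)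
    with Suc t show ?thesis by simp
  next
    case False
    with t show ?thesis by simp
  qed
qed simp

lemma uniform_wise_intersecting_bound:
  assumes "0 < t" "finite L" "m_family n m F" "uniform_family k F" "wise_intersecting t L F"
  shows "m * k \<le> n * (t - 1) + (m choose t) * Max L"
proof -
  let ?X = "{1..n}" and ?T = "{G. G \<subseteq> F \<and> card G = t}"
  have F: "F \<subseteq> Pow ?X" "card F = m" and k: "\<And>A. A \<in> F \<Longrightarrow> card A = k"
    using assms(3,4) by (auto simp: m_family_def uniform_family_def)
  have finF: "finite F" using F(1) by (rule finite_subset) simp
  have finT: "finite ?T" using finF by simp
  have "(\<Sum>x\<in>?X. degree F id x choose t) = (\<Sum>x\<in>?X. degree ?T Inter x)"
  proof (rule sum.cong)
    fix x
    have "{G\<in>?T. x \<in> \<Inter>G} = {G. G \<subseteq> {A\<in>F. x \<in> A} \<and> card G = t}" by auto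
    then show "(degree F id x choose t) = degree ?T Inter x"
      using finF by (simp add: degree_def n_subsets)
  qed simp
  also have "\<dots> = (\<Sum>G\<in>?T. card (\<Inter>G))"
  proof (rule sum_degree)
    fix G assume "G \<in> ?T"
    \<comment> \<open>The empty intersection would be the whole type, not a subset of
      \<open>?X\<close>.\<close>
    moreover from this have "G \<noteq> {}" using assms(1) by auto
    ultimately show "\<Inter>G \<subseteq> ?X" using F(1) by blast
  qed (use finT in auto)
  also have "\<dots> \<le> (\<Sum>G\<in>?T. Max L)"
    using assms(2,5) by (intro sum_mono) (auto simp: wise_intersecting_def)
  also have "\<dots> = (m choose t) * Max L" using finF F(2) by (simp add: n_subsets)
  finally have choose: "(\<Sum>x\<in>?X. degree F id x choose t) \<le> (m choose t) * Max L" .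
  have "m * k = (\<Sum>A\<in>F. card (id A))" using k F(2) by simp
  also have "\<dots> = (\<Sum>x\<in>?X. degree F id x)"
    using finF F(1) by (intro sum_degree[symmetric]) auto
  also have "\<dots> \<le> (\<Sum>x\<in>?X. (degree F id x choose t) + (t - 1))"
    using assms(1) by (intro sum_mono le_choose_add)
  also have "\<dots> \<le> n * (t - 1) + (m choose t) * Max L"
    using choose by (simp add: sum.distrib)
  finally show ?thesis .
qed

section \<open>Balanced families\<close>

text \<open>Stated additively to avoid truncated subtraction.\<close>

lemma degree_exchange:
  assumes "finite F" "p \<in> F" "q \<notin> F"
  shows "degree (insert q (F - {p})) S z + of_bool (z \<in> S p) = degree F S z + of_bool (z \<in> S q)"
proof -
  let ?D = "{u\<in>F - {p}. z \<in> S u}"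
  have "{u\<in>insert q (F - {p}). z \<in> S u} = (if z \<in> S q then insert q ?D else ?D)"
       "{u\<in>F. z \<in> S u} = (if z \<in> S p then insert p ?D else ?D)"
    using assms by auto
  then show ?thesis using assms unfolding degree_def by simp
qed

text \<open>Sets with x but not y outnumber sets with y but not x. Replacing x by y is injective on
  the former, so it cannot send all of them into the latter, and some replacement is a new set with
  the same label.\<close>

lemma exists_balancing_exchange:
  assumes "finite F" "degree F fst y < degree F fst x"
  obtains A c where "(A, c) \<in> F" "x \<in> A" "y \<notin> A" "(insert y (A - {x}), c) \<notin> F"
proof -
  let ?U = "{p\<in>F. x \<in> fst p \<and> y \<notin> fst p}" and ?V = "{p\<in>F. y \<in> fst p \<and> x \<notin> fst p}"
  let ?W = "{p\<in>F. x \<in> fst p \<and> y \<in> fst p}"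
  let ?g = "\<lambda>p. (insert y (fst p - {x}), snd p)"
  have "{p\<in>F. x \<in> fst p} = ?U \<union> ?W" "{p\<in>F. y \<in> fst p} = ?V \<union> ?W" by auto
  moreover have "card (?U \<union> ?W) = card ?U + card ?W" "card (?V \<union> ?W) = card ?V + card ?W"
    using assms(1) by (intro card_Un_disjoint; auto)+
  ultimately have less: "card ?V < card ?U" using assms(2) by (simp add: degree_def)
  have "inj_on ?g ?U"
  proof (rule inj_onI)
    fix p q assume p: "p \<in> ?U" and q: "q \<in> ?U" and eq: "?g p = ?g q"
    from p q have "fst p = insert x (insert y (fst p - {x}) - {y})"
      "fst q = insert x (insert y (fst q - {x}) - {y})" by auto
    with eq show "p = q" by (simp add: prod_eq_iff)
  qed
  then have "\<not> ?g ` ?U \<subseteq> ?V"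
    using less card_mono[of ?V "?g ` ?U"] assms(1) by (auto simp: card_image)
  then obtain p where p: "p \<in> ?U" "?g p \<notin> ?V" by blast
  then have "?g p \<notin> F" by auto
  with p that[of "fst p" "snd p"] show ?thesis by simp
qed

text \<open>The bound on m supplies a family from which to minimise; the bound on m k says that the
  average degree is at most s.\<close>

lemma exists_balanced_family:
  fixes X :: "'a set" and C :: "'c set"
  assumes X: "finite X" and C: "finite C"
    and m: "m \<le> (card X choose k) * card C" and mk: "m * k \<le> card X * s"
  obtains F where "F \<subseteq> {A. A \<subseteq> X \<and> card A = k} \<times> C" "card F = m"
    "\<And>x. x \<in> X \<Longrightarrow> degree F fst x \<le> s"
proof -
  let ?K = "{A. A \<subseteq> X \<and> card A = k} \<times> C"
  let ?P = "\<lambda>F. F \<subseteq> ?K \<and> card F = m"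
  define \<Phi> where "\<Phi> F = (\<Sum>x\<in>X. (degree F fst x)\<^sup>2)" for F :: "('a set \<times> 'c) set"
  have finK: "finite ?K" using X C by simp
  have "card ?K = (card X choose k) * card C" using X by (simp add: card_cartesian_product n_subsets)
  with m obtain F0 where "?P F0" using obtain_subset_with_card_n[of m ?K] by auto
  then have "?P (arg_min \<Phi> ?P)" "\<forall>F'. ?P F' \<longrightarrow> \<Phi> (arg_min \<Phi> ?P) \<le> \<Phi> F'"
    using arg_min_nat_lemma[of ?P F0 \<Phi>] by blast+
  then obtain F where F: "F \<subseteq> ?K" "card F = m" and min: "\<And>F'. ?P F' \<Longrightarrow> \<Phi> F \<le> \<Phi> F'"
    by blast
  have finF: "finite F" using F(1) finK by (rule finite_subset)
  have "(\<Sum>p\<in>F. card (fst p)) = (\<Sum>p\<in>F. k)" using F(1) by (intro sum.cong) auto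
  moreover have "(\<Sum>x\<in>X. degree F fst x) = (\<Sum>p\<in>F. card (fst p))"
    using finF X subsetD[OF F(1)] by (intro sum_degree) fastforce+
  ultimately have total: "(\<Sum>x\<in>X. degree F fst x) = m * k" using F(2) by simp
  have "degree F fst x \<le> s" if x: "x \<in> X" for x
  proof (rule ccontr)
    assume "\<not> degree F fst x \<le> s"
    then have dx: "s < degree F fst x" by simp
    \<comment> \<open>A point above the average bound s forces another point strictly below s, which
      gives a gap of at least 2.\<close>
    have "\<exists>y\<in>X. degree F fst y < s"
    proof (rule ccontr)
      assume "\<not> (\<exists>y\<in>X. degree F fst y < s)"
      then have "(\<Sum>y\<in>X. s) < (\<Sum>y\<in>X. degree F fst y)"
        using X x dx by (intro sum_strict_mono_ex1) (auto simp: not_less)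
      with total mk show False by simp
    qed
    then obtain y where y: "y \<in> X" and dy: "degree F fst y < s" by blast
    have xy: "x \<noteq> y" using dx dy by auto
    obtain A c where A: "(A, c) \<in> F" "x \<in> A" "y \<notin> A" and B: "(insert y (A - {x}), c) \<notin> F"
      using exists_balancing_exchange[OF finF] dx dy by (metis less_trans)
    let ?B = "insert y (A - {x})"
    define F' where "F' = insert (?B, c) (F - {(A, c)})"
    have AX: "A \<subseteq> X" "card A = k" "c \<in> C" using A(1) F(1) by auto
    have "finite A" using AX(1) X by (rule finite_subset)
    with A AX(2) have "card ?B = k"
      by (metis card_Suc_Diff1 card_insert_disjoint finite_Diff Diff_iff)
    then have "F' \<subseteq> ?K" using AX F(1) y unfolding F'_def by auto
    moreover have "card F' = m"
      using A(1) B finF F(2) card_Suc_Diff1[of F "(A, c)"] unfolding F'_def by simp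
    ultimately have le: "\<Phi> F \<le> \<Phi> F'" using min by blast
    have deg: "degree F' fst z + of_bool (z \<in> A) = degree F fst z + of_bool (z \<in> ?B)" for z
      using degree_exchange[OF finF A(1) B, of fst z] by (simp add: F'_def)
    have d: "Suc (degree F' fst x) = degree F fst x" "degree F' fst y = Suc (degree F fst y)"
      using deg[of x] deg[of y] A(2,3) xy by auto
    have rest: "degree F' fst z = degree F fst z" if "z \<in> X - {x} - {y}" for z
      using deg[of z] that by auto
    have split: "\<Phi> G = (degree G fst x)\<^sup>2 + ((degree G fst y)\<^sup>2
        + (\<Sum>z\<in>X - {x} - {y}. (degree G fst z)\<^sup>2))" for G
      unfolding \<Phi>_def using X x y xy by (simp add: sum.remove[of X x] sum.remove[of "X - {x}" y])
    have "(\<Sum>z\<in>X - {x} - {y}. (degree F' fst z)\<^sup>2) = (\<Sum>z\<in>X - {x} - {y}. (degree F fst z)\<^sup>2)"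
      by (intro sum.cong) (simp_all add: rest)
    with le have "(degree F fst x)\<^sup>2 + (degree F fst y)\<^sup>2 \<le> (degree F' fst x)\<^sup>2 + (degree F' fst y)\<^sup>2"
      by (simp add: split)
    moreover have "degree F fst y < degree F' fst x" using d(1) dx dy by simp
    \<comment> \<open>With a the new degree of x and b the old degree of y, (a + 1)^2 + b^2 <= a^2 +
      (b + 1)^2 would give a <= b.\<close>
    ultimately show False unfolding d(1)[symmetric] d(2) by (simp add: power2_eq_square)
  qed
  with F that show ?thesis by blast
qed

section \<open>The construction\<close>

lemma card_subsets_containing:
  assumes "finite F" "p \<in> F" "0 < t"
  shows "card {T. T \<subseteq> F \<and> card T = t \<and> p \<in> T} = (card F - 1) choose (t - 1)"
proof -
  let ?A = "{T. T \<subseteq> F \<and> card T = t}" and ?B = "{T. T \<subseteq> F - {p} \<and> card T = t}"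
  have "0 < card F" using assms card_gt_0_iff by blast
  then have "card F choose t = ((card F - 1) choose (t - 1)) + ((card F - 1) choose t)"
    using assms(3) by (cases "card F"; cases t) auto
  moreover have "{T. T \<subseteq> F \<and> card T = t \<and> p \<in> T} = ?A - ?B" by auto
  moreover have "card (?A - ?B) = card ?A - card ?B"
    using assms(1) by (intro card_Diff_subset) auto
  ultimately show ?thesis using assms by (simp add: n_subsets)
qed

lemma exists_family_from_balanced:
  fixes F :: "('a set \<times> 'c) set"
  assumes t: "0 < t" and finF: "finite F" and cF: "card F = m" and X: "finite X"
    and FX: "\<And>p. p \<in> F \<Longrightarrow> fst p \<subseteq> X \<and> card (fst p) = k"
    and deg: "\<And>x. x \<in> X \<Longrightarrow> degree F fst x < t"
    and n: "card X + (m choose t) * l = n" and l: "l \<in> L"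
    and dist: "inj_on fst F \<or> (0 < l \<and> t < m)"
  obtains G where "m_family n m G" "uniform_family (k + ((m - 1) choose (t - 1)) * l) G"
    "wise_intersecting t L G"
proof -
  let ?T = "{T. T \<subseteq> F \<and> card T = t}"
  \<comment> \<open>\<open>Inl\<close> marks base points and \<open>Inr (T, j)\<close> the l private
    points of the t-subset T; the size is exactly n, so \<open>h\<close> below can carry everything
    over to \<open>{1..n}\<close>.\<close>
  define Y where "Y = X <+> (?T \<times> {..<l})"
  define S where "S p = fst p <+> ({T. T \<subseteq> F \<and> card T = t \<and> p \<in> T} \<times> {..<l})" for p
  have finY: "finite Y" unfolding Y_def using X finF by simp
  have "card Y = n"
    unfolding Y_def using X finF cF n by (simp add: card_Plus card_cartesian_product n_subsets)
  with finY obtain h where h: "bij_betw h Y {1..n}"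
    using finite_same_card_bij[of Y "{1..n}"] by auto
  have SY: "S p \<subseteq> Y" if "p \<in> F" for p
    using FX[OF that] unfolding S_def Y_def by auto
  have injh: "inj_on h Y" using h by (rule bij_betw_imp_inj_on)
  have "inj_on S F"
  proof (rule inj_onI, rule ccontr)
    fix p q assume p: "p \<in> F" and q: "q \<in> F" and eq: "S p = S q" and ne: "p \<noteq> q"
    from eq have "fst p = fst q" unfolding S_def by blast
    with dist p q ne have l0: "0 < l" and tm: "t < m" by (auto dest: inj_onD)
    \<comment> \<open>Since t < m, some t-subset contains p but avoids q, and its private points
      separate \<open>S p\<close> from \<open>S q\<close>.\<close>
    have "t - 1 \<le> card (F - {p, q})" using tm ne p q cF finF by (simp add: card_Diff_subset)
    then obtain T where T: "T \<subseteq> F - {p, q}" "card T = t - 1" "finite T"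
      using obtain_subset_with_card_n by metis
    then have "card (insert p T) = t" using t by (subst card_insert_disjoint) auto
    then have "Inr (insert p T, 0) \<in> S p" unfolding S_def using T(1) p l0 by auto
    with eq have "Inr (insert p T, 0) \<in> S q" by simp
    then show False unfolding S_def using T(1) ne by auto
  qed
  moreover have "inj_on (image h) (S ` F)"
    using SY by (intro inj_on_subset[OF inj_on_image_Pow[OF injh]]) auto
  ultimately have inj: "inj_on (\<lambda>p. h ` S p) F"
    using comp_inj_on[of S F "image h"] by (simp add: comp_def)
  have cS: "card (S p) = k + ((m - 1) choose (t - 1)) * l" if "p \<in> F" for p
    unfolding S_def using FX[OF that] finite_subset[OF _ X] finF that t cF
    by (simp add: card_Plus card_cartesian_product card_subsets_containing)
  let ?G = "(\<lambda>p. h ` S p) ` F"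
  have "h ` S p \<subseteq> {1..n}" if "p \<in> F" for p
    using SY[OF that] h unfolding bij_betw_def by blast
  then have "m_family n m ?G"
    unfolding m_family_def using inj cF by (auto simp: card_image)
  moreover have "uniform_family (k + ((m - 1) choose (t - 1)) * l) ?G"
    unfolding uniform_family_def
    using cS SY by (auto simp: card_image inj_on_subset[OF injh])
  moreover have "wise_intersecting t L ?G"
    unfolding wise_intersecting_def
  proof (intro allI impI)
    fix H assume H: "H \<subseteq> ?G" "card H = t"
    from H(1) obtain T where T: "T \<subseteq> F" "H = (\<lambda>p. h ` S p) ` T" by (auto simp: subset_image_iff)
    have cT: "card T = t" using H(2) T card_image[OF inj_on_subset[OF inj T(1)]] by simp
    then have T0: "T \<noteq> {}" using t by auto
    \<comment> \<open>No base point has degree t. A private point of U lies only in the members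
      indexed by U, so T is contained in U, and equal sizes give T = U.\<close>
    have S_Int: "(\<Inter>p\<in>T. S p) = Inr ` ({T} \<times> {..<l})"
    proof (rule equalityI; rule subsetI)
      fix z assume z: "z \<in> (\<Inter>p\<in>T. S p)"
      show "z \<in> Inr ` ({T} \<times> {..<l})"
      proof (cases z)
        case (Inl x)
        then have x: "x \<in> fst p" if "p \<in> T" for p using z that unfolding S_def by auto
        then have "x \<in> X" using T0 T(1) FX by blast
        moreover have "card T \<le> degree F fst x"
          unfolding degree_def using finF T(1) x by (intro card_mono) auto
        ultimately show ?thesis using deg cT by (metis leD)
      next
        case (Inr w)
        obtain U j where w: "w = (U, j)" by (cases w)
        have U: "U \<subseteq> F" "card U = t" "j < l" "T \<subseteq> U"
          using z T0 unfolding Inr w S_def by auto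
        then have "T = U" using cT finF by (metis card_subset_eq finite_subset)
        then show ?thesis using U Inr w by auto
      qed
    next
      show "z \<in> (\<Inter>p\<in>T. S p)" if "z \<in> Inr ` ({T} \<times> {..<l})" for z
        using that T(1) cT unfolding S_def by auto
    qed
    obtain p where "p \<in> T" using T0 by blast
    then have "\<Inter>H = h ` (\<Inter>p\<in>T. S p)"
      unfolding T(2) using T(1) SY by (intro image_INT[OF injh, symmetric]) auto
    moreover have "(\<Inter>p\<in>T. S p) \<subseteq> Y" using T0 T(1) SY by blast
    ultimately have "card (\<Inter>H) = card (\<Inter>p\<in>T. S p)"
      using card_image[OF inj_on_subset[OF injh]] by metis
    also have "\<dots> = l" unfolding S_Int by (simp add: card_image card_cartesian_product)
    finally show "card (\<Inter>H) \<in> L" using l by simp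
  qed
  ultimately show ?thesis using that by blast
qed

lemma exists_extremal_family:
  assumes t: "0 < t" and tm: "t \<le> m" and l: "l \<in> L" and n: "r + (m choose t) * l = n"
    and dist: "m \<le> r choose (r * (t - 1) div m) \<or> (0 < l \<and> t < m)"
  obtains G where "m_family n m G" "wise_intersecting t L G"
    "uniform_family (r * (t - 1) div m + ((m - 1) choose (t - 1)) * l) G"
proof -
  let ?k = "r * (t - 1) div m"
  \<comment> \<open>A single label forces distinct sets when there are enough of them. Otherwise m
    labels allow even one set to be repeated m times.\<close>
  define C where "C = (if m \<le> r choose ?k then {0} else {..<m})"
  have finC: "finite C" by (simp add: C_def)
  have "r * (t - 1) \<le> r * m" using tm by (intro mult_le_mono) auto
  then have "?k \<le> r" using t tm by (metis div_le_mono nonzero_mult_div_cancel_right le_zero_eq not_gr0)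
  then have "0 < r choose ?k" by simp
  then have "m \<le> (r choose ?k) * m" by (cases "r choose ?k") auto
  then have "m \<le> (r choose ?k) * card C" unfolding C_def by simp
  moreover have "m * ?k \<le> r * (t - 1)" by (rule times_div_less_eq_dividend)
  ultimately obtain F where F: "F \<subseteq> {A. A \<subseteq> {..<r} \<and> card A = ?k} \<times> C" "card F = m"
    "\<And>x. x \<in> {..<r} \<Longrightarrow> degree F fst x \<le> t - 1"
    using exists_balanced_family[of "{..<r}" C m ?k "t - 1", unfolded card_lessThan,
        OF finite_lessThan finC] by blast
  have finF: "finite F" using F(2) t tm by (intro card_ge_0_finite) simp
  have "inj_on fst F \<or> (0 < l \<and> t < m)"
  proof (cases "m \<le> r choose ?k")
    case True
    then have "snd p = 0" if "p \<in> F" for p using F(1) that by (auto simp: C_def)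
    then show ?thesis by (auto simp: inj_on_def prod_eq_iff)
  qed (use dist in blast)
  moreover have "fst p \<subseteq> {..<r} \<and> card (fst p) = ?k" if "p \<in> F" for p
    using subsetD[OF F(1) that] by auto
  moreover have "degree F fst x < t" if "x \<in> {..<r}" for x using F(3)[OF that] t by simp
  moreover have "card {..<r} + (m choose t) * l = n" using n by simp
  ultimately show ?thesis
    using exists_family_from_balanced[OF t finF F(2) finite_lessThan _ _ _ l] that by blast
qed

lemma exists_copoint_family:
  assumes "0 < t" "n = l + t" "l \<in> L"
  obtains G where "m_family n t G" "uniform_family (n - 1) G" "wise_intersecting t L G"
proof
  let ?G = "(\<lambda>x. {1..n} - {x}) ` {1..t}"
  have "inj_on (\<lambda>x. {1..n} - {x}) {1..t}"
  proof (rule inj_onI)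
    fix x y assume "x \<in> {1..t}" and eq: "{1..n} - {x} = {1..n} - {y}"
    then have "x \<in> {1..n}" using assms(2) by simp
    with eq show "x = y" by blast
  qed
  then have card: "card ?G = t" by (simp add: card_image)
  then show "m_family n t ?G" by (auto simp: m_family_def)
  show "uniform_family (n - 1) ?G" using assms(2) by (auto simp: uniform_family_def)
  have "\<Inter>?G = {1..n} - {1..t}" using assms(1) by auto
  then have "card (\<Inter>?G) = l" using assms(2) by (simp add: card_Diff_subset)
  \<comment> \<open>With exactly t members, the only t-subfamily is the whole family.\<close>
  then show "wise_intersecting t L ?G"
    unfolding wise_intersecting_def using assms(3) card
    by (metis card_subset_eq finite_imageI finite_atLeastAtMost)
qed

text \<open>By Pascal's rule each step of r adds at least 1. When m = t, this provides enough
  distinct base sets.\<close>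

lemma le_choose_self:
  assumes "0 < k" "k < r"
  shows "r \<le> r choose k"
  using assms
proof (induction r)
  case (Suc r)
  obtain j where k: "k = Suc j" using Suc.prems by (cases k) auto
  show ?case
  proof (cases "k = r")
    case False
    then have "r \<le> r choose k" "1 \<le> r choose j" using Suc k by (auto simp: Suc_le_eq)
    then show ?thesis by (simp add: k)
  qed simp
qed simp

section \<open>The value of kappa\<close>

text \<open>The last assumption puts K + 1 beyond the upper bound, so the set of admissible sizes is
  finite and K is its maximum.\<close>

lemma kappa_eqI:
  assumes "0 < t" "0 < m" "finite L" "m_family n m F" "uniform_family K F" "wise_intersecting t L F"
    and "n * (t - 1) + (m choose t) * Max L < m * Suc K"
  shows "kappa t L n m = K"
proof -
  let ?S = "{k. \<exists>F. m_family n m F \<and> uniform_family k F \<and> wise_intersecting t L F}"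
  have le: "k \<le> K" if k: "k \<in> ?S" for k
  proof -
    have "m * k \<le> n * (t - 1) + (m choose t) * Max L"
      using k uniform_wise_intersecting_bound[OF assms(1,3)] by blast
    also have "\<dots> < m * Suc K" by (rule assms)
    finally show ?thesis using assms(2) unfolding mult_less_cancel1 by simp
  qed
  then have "finite ?S" by (meson finite_nat_set_iff_bounded_le)
  with le assms show ?thesis unfolding kappa_def by (intro Max_eqI) auto
qed

text \<open>The last two assumptions exclude degenerate cases. A uniform family of m distinct k-sets
  needs m <= C(n, k); this fails for L = {0}, n = 0, m = t = 2. If m = t and l < n < l + t with l =
  max L, the formula gives n - 1, and t distinct (n - 1)-sets meet in n - t points, so n - t must
  lie in L.\<close>

theorem theorem4p2:
  fixes t m n :: nat and L :: "nat set"
  assumes t_ge: "2 \<le> t"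
    and m_ge: "t \<le> m"
    and L_fin: "finite L"
    and L_ne: "L \<noteq> {}"
    and n_ge: "(m choose t) * Max L \<le> n"
    and enough_sets: "Max L = 0 \<or> m = t \<Longrightarrow>
      m \<le> n choose nat \<lfloor>real n * (real t - 1) / real m
                        + real (Max L) / real m * real (m choose t)\<rfloor>"
    and enough_points: "m = t \<Longrightarrow> Max L + t \<le> n \<or> (\<exists>l\<in>L. n = l + t)"
  shows "int (kappa t L n m) =
    \<lfloor>real n * (real t - 1) / real m + real (Max L) / real m * real (m choose t)\<rfloor>"
proof -
  define l where "l = Max L"
  define N where "N = n * (t - 1) + (m choose t) * l"
  define r where "r = n - (m choose t) * l"
  let ?k = "r * (t - 1) div m"
  have m0: "0 < m" and t0: "0 < t" using t_ge m_ge by auto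
  have l: "l \<in> L" unfolding l_def using L_fin L_ne by (rule Max_in)
  have r: "r + (m choose t) * l = n" using n_ge by (simp add: r_def l_def)
  have "real n * (real t - 1) / real m + real (Max L) / real m * real (m choose t)
      = real N / real m"
    using t0 by (simp add: N_def l_def of_nat_diff add_divide_distrib)
  then have floor: "\<lfloor>real n * (real t - 1) / real m + real (Max L) / real m * real (m choose t)\<rfloor>
      = int (N div m)"
    by (simp add: floor_divide_of_nat_eq)
  \<comment> \<open>Substituting for n yields the private points t - 1 times, and the second summand
    of N once more. Then t C(m, t) = m C(m - 1, t - 1) makes that part divisible by m.\<close>
  have "N = r * (t - 1) + t * (m choose t) * l"
    unfolding N_def r[symmetric] using t0 by (cases t) (auto simp: algebra_simps)
  then have "N = r * (t - 1) + m * (((m - 1) choose (t - 1)) * l)"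
    using times_binomial_minus1_eq[OF t0, of m] by (simp add: mult.assoc)
  then have K: "N div m = ?k + ((m - 1) choose (t - 1)) * l" using m0 by simp
  have sets: "m \<le> n choose (N div m)" if "l = 0 \<or> m = t"
    using enough_sets that unfolding floor l_def by simp
  have "\<exists>G. m_family n m G \<and> uniform_family (N div m) G \<and> wise_intersecting t L G" (is ?ex)
  proof -
    have extremal: ?ex if "m \<le> r choose ?k \<or> (0 < l \<and> t < m)"
      using exists_extremal_family[OF t0 m_ge l r that] unfolding K by metis
    \<comment> \<open>Members are distinct through \<open>sets\<close> if l = 0 (then r = n),
      through private points if t < m, and through base sets if m = t and r >= t. The copoints
      settle the rest.\<close>
    consider "l = 0" | "0 < l" "t < m" | "m = t" "l + t \<le> n" | l' where "m = t" "n < l + t" "l' \<in> L" "n = l' + t"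
      using m_ge enough_points unfolding l_def by fastforce
    then show ?ex
    proof cases
      case 1
      then show ?thesis using extremal sets K r by simp
    next
      case 2
      then show ?thesis using extremal by blast
    next
      case 3
      then have rt: "t \<le> r" using r by simp
      \<comment> \<open>As m = t, this gives 0 < \<open>?k\<close> < r, hence C(r,
        \<open>?k\<close>) >= r >= m.\<close>
      have "t * 1 \<le> r * (t - 1)" using rt t_ge by (intro mult_le_mono) auto
      then have "0 < ?k" using 3 t0 by (simp add: div_greater_zero_iff)
      moreover have "?k < r"
        using 3 t0 rt by (simp add: div_less_iff_less_mult)
      ultimately show ?thesis using extremal le_choose_self[of ?k r] rt 3 by simp
    next
      case 4
      \<comment> \<open>If n = l, the quotient is n, but there is only one n-subset, contrary to
        \<open>sets\<close>.\<close>
      have "n \<noteq> l"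
      proof
        assume "n = l"
        then have "N = n * t" unfolding N_def using 4(1) t0 by (cases t) auto
        then show False using sets 4(1) t_ge by simp
      qed
      then have "l < n" using 4 r by simp
      \<comment> \<open>Here N = n t - (n - l) with 0 < n - l < t.\<close>
      then have "N div m = n - 1"
        unfolding N_def using 4 t0 by (intro div_nat_eqI; cases t; cases n) (auto simp: algebra_simps)
      with exists_copoint_family[OF t0 4(4,3)] 4 show ?thesis by metis
    qed
  qed
  then obtain G where G: "m_family n m G" "uniform_family (N div m) G" "wise_intersecting t L G"
    by blast
  have "N < m * Suc (N div m)" using dividend_less_times_div[OF m0] by simp
  then have "kappa t L n m = N div m"
    using kappa_eqI[OF t0 m0 L_fin G] unfolding N_def l_def by simp
  then show ?thesis using floor by simp
qed

end
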